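(* Let $a>0$. For each $n\ge2$ let $X^{(n)}$ be the simple random walk on the complete graph with $n$ vertices, i.e. with vertex set $V^{(n)}$, $\sharp V^{(n)}=n$, and $p^{(n)}(x,y)=\frac{1}{n-1}1_{x\ne y}$, and let $c^{(n)}>0$ satisfy $c^{(n)}=n^{-a+o(1)}$ as $n\to\infty$. Let $\mu^{(n)}$ be the associated loop measure (defined in the context), and let $\mathcal{L}_n$ be a Poisson point process of loops with intensity measure $\mu^{(n)}/\log n$. Let $\mathcal{C}$ denote the set of loops which cover (visit) all the vertices of the graph. Then, as $n\to\infty$, $\sum_{\ell\in\mathcal{L}_n}1_{\ell\in\mathcal{C}}$ (points counted with multiplicity) converges in distribution to a Poisson random variable with mean $\max(a-1,0)$.
   Context: A based loop on $V^{(n)}$ is an element $\dot\ell=(x_1,\ldots,x_k)\in (V^{(n)})^k$, $k\ge1$. Two based loops are equivalent if they coincide up to a circular permutation, and a loop $\ell$ is an equivalence class of based loops. The based loop measure $\dot\mu^{(n)}$ gives the based loop $\dot\ell=(x_1,\ldots,x_k)$ the mass $$\dot\mu^{(n)}(\dot\ell)=\frac1k(1+c^{(n)})^{-k}\,p^{(n)}(x_1,x_2)p^{(n)}(x_2,x_3)\cdots p^{(n)}(x_k,x_1)$$ (for $k=1$ the product is $p^{(n)}(x_1,x_1)$). The loop measure $\mu^{(n)}$ is the push-forward of $\dot\mu^{(n)}$ to the space of loops; it has finite total mass. A Poisson random variable with mean $0$ is the constant $0$. *)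

theory Defs
  imports "HOL-Probability.Probability"
begin

definition based_loops :: "'v set \<Rightarrow> 'v list set" where
  "based_loops V = {xs. xs \<noteq> [] \<and> set xs \<subseteq> V}"

definition loop_rel :: "'v set \<Rightarrow> ('v list \<times> 'v list) set" where
  "loop_rel V = {(xs, ys). xs \<in> based_loops V \<and> ys \<in> based_loops V \<and> (\<exists>m. ys = rotate m xs)}"

lemma equiv_loop_rel: "equiv (based_loops V) (loop_rel V)"
proof (rule equivI)
  show "sym (loop_rel V)"
  proof (rule symI)
    fix xs ys assume *: "(xs, ys) \<in> loop_rel V"
    then obtain m where ys: "ys = rotate m xs" by (auto simp: loop_rel_def)
    have "rotate (length xs - m mod length xs) ys = rotate (length xs - m mod length xs + m mod length xs) xs"
      unfolding ys by (subst (2) rotate_conv_mod) (simp only: rotate_rotate)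
    also have "length xs - m mod length xs + m mod length xs = length xs"
      using * by (auto simp: loop_rel_def based_loops_def less_imp_le)
    finally have "xs = rotate (length xs - m mod length xs) ys" by simp
    with * show "(ys, xs) \<in> loop_rel V" by (auto simp: loop_rel_def)
  qed
  show "refl_on (based_loops V) (loop_rel V)"
    by (auto simp: refl_on_def loop_rel_def intro: exI[of _ 0])
  show "trans (loop_rel V)"
    by (auto simp: trans_def loop_rel_def rotate_rotate)
qed (auto simp: loop_rel_def)

definition loops :: "'v set \<Rightarrow> 'v list set set" where
  "loops V = based_loops V // loop_rel V"

definition based_loop_mass :: "('v \<Rightarrow> 'v \<Rightarrow> real) \<Rightarrow> real \<Rightarrow> 'v list \<Rightarrow> real" where
  "based_loop_mass p c xs =
     (let k = length xs in
       1 / real k * (1 / (1 + c)) ^ k * (\<Prod>i<k. p (xs ! i) (xs ! (Suc i mod k))))"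

definition based_loop_measure :: "'v set \<Rightarrow> ('v \<Rightarrow> 'v \<Rightarrow> real) \<Rightarrow> real \<Rightarrow> 'v list measure" where
  "based_loop_measure V p c = point_measure (based_loops V) (\<lambda>xs. ennreal (based_loop_mass p c xs))"

definition loop_measure :: "'v set \<Rightarrow> ('v \<Rightarrow> 'v \<Rightarrow> real) \<Rightarrow> real \<Rightarrow> 'v list set measure" where
  "loop_measure V p c =
     distr (based_loop_measure V p c) (count_space (loops V)) (\<lambda>xs. loop_rel V `` {xs})"

definition covering_loops :: "'v set \<Rightarrow> 'v list set set" where
  "covering_loops V = {l \<in> loops V. \<forall>x\<in>V. \<exists>xs\<in>l. x \<in> set xs}"

definition complete_graph_walk :: "nat \<Rightarrow> 'v \<Rightarrow> 'v \<Rightarrow> real" where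
  "complete_graph_walk n x y = (if x \<noteq> y then 1 / (real n - 1) else 0)"

text \<open>The library's \<open>poisson_pmf\<close> is only specified for a positive rate; mean 0 is the constant 0.\<close>

definition poisson_dist :: "real \<Rightarrow> nat pmf" where
  "poisson_dist r = (if r = 0 then return_pmf 0 else poisson_pmf r)"

text \<open>
  A configuration is a finite multiset of points, which suffices for intensities \<open>\<nu>\<close>
  of finite total mass. Finiteness of \<open>\<nu>\<close> is not itself assumed here.
\<close>

locale poisson_point_process = prob_space M
  for M :: "'w measure" and \<nu> :: "'p measure" and N :: "'w \<Rightarrow> 'p multiset" +
  assumes points_in_space: "\<And>\<omega>. \<omega> \<in> space M \<Longrightarrow> set_mset (N \<omega>) \<subseteq> space \<nu>"
    and measurable_count:
      "\<And>A. A \<in> sets \<nu> \<Longrightarrow> (\<lambda>\<omega>. size {#x \<in># N \<omega>. x \<in> A#}) \<in> measurable M (count_space UNIV)"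
    and poisson_count:
      "\<And>A. A \<in> sets \<nu> \<Longrightarrow> emeasure \<nu> A < \<infinity> \<Longrightarrow>
         distr M (count_space UNIV) (\<lambda>\<omega>. size {#x \<in># N \<omega>. x \<in> A#})
           = measure_pmf (poisson_dist (measure \<nu> A))"
    and indep_counts:
      "\<And>(I :: nat set) (A :: nat \<Rightarrow> 'p set). finite I \<Longrightarrow> (\<And>i. i \<in> I \<Longrightarrow> A i \<in> sets \<nu>) \<Longrightarrow> disjoint_family_on A I \<Longrightarrow>
         indep_vars (\<lambda>_. count_space UNIV) (\<lambda>i \<omega>. size {#x \<in># N \<omega>. x \<in> A i#}) I"

end

theory Submission
  imports Defs "HOL-Real_Asymp.Real_Asymp"
begin

text \<open>
  The number of covering loops in the point process is Poisson distributed, and its mean is the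
  mass of the covering loops divided by \<open>ln n\<close>. The Poisson weights depend continuously on the mean,
  also at mean 0, so everything reduces to showing that this mean tends to \<open>max (a - 1) 0\<close>.

  Grouped by length, the mass of the covering loops is the sum over \<open>k\<close> of
  \<open>1/k * (1 + c)^(-k) * q k\<close>, where \<open>q k\<close> is the number of closed walks of length \<open>k\<close> on the complete
  graph that visit all vertices, divided by \<open>(n - 1)^k\<close>. Three regimes explain the limit. For
  \<open>k < n\<close> a walk cannot cover, so \<open>q k = 0\<close>. For \<open>k\<close> a little larger than \<open>n\<close>, at
  \<open>k \<ge> n^(1+d)\<close>, a walk misses a given vertex with probability at most about \<open>exp (- n^d)\<close>, hence
  covers with overwhelming probability, while closing up costs a factor about \<open>1/n\<close> that is
  compensated by the \<open>n\<close> starting points; so \<open>q k\<close> is close to 1. Finally the killing factor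
  \<open>(1 + c)^(-k)\<close> is close to 1 for \<open>k\<close> well below \<open>1/c\<close>, which is about \<open>n^a\<close>, and cuts the sum off
  beyond that. What remains is the harmonic sum of \<open>1/k\<close> from \<open>n\<close> to \<open>n^a\<close>, which is
  about \<open>(a - 1) * ln n\<close> if \<open>a > 1\<close> and negligible against \<open>ln n\<close> otherwise.

  The upper estimate is \<open>suminf_covering_mass_le\<close>, with cutoff at \<open>n^(max a 1 + d)\<close>; the lower
  estimate is \<open>suminf_covering_mass_ge\<close>, applied to lengths between \<open>n^(1+d)\<close> and \<open>n^(a-2*d)\<close>.
  Only crude bounds on the number of covering walks are needed, because \<open>d\<close> may be taken
  arbitrarily small.
\<close>

section \<open>Counting closed walks on the complete graph\<close>

text \<open>
  The index \<open>Suc i mod k\<close> matches the cyclic product in the mass of a based loop. For \<open>k = 1\<close> it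
  compares the only vertex with itself, so there is no closed walk of length 1.
\<close>

definition closed_walks :: "'v set \<Rightarrow> nat \<Rightarrow> 'v list set" where
  "closed_walks V k =
     {xs. length xs = k \<and> set xs \<subseteq> V \<and> (\<forall>i<k. xs ! i \<noteq> xs ! (Suc i mod k))}"

definition covering_walks :: "'v set \<Rightarrow> nat \<Rightarrow> 'v list set" where
  "covering_walks V k = {xs \<in> closed_walks V k. V \<subseteq> set xs}"

lemma card_open_walks:
  assumes "finite V"
  shows "card {xs. length xs = Suc k \<and> set xs \<subseteq> V \<and> distinct_adj xs} = card V * (card V - 1) ^ k"
proof (induction k)
  case 0
  have "{xs. length xs = Suc 0 \<and> set xs \<subseteq> V \<and> distinct_adj xs} = (\<lambda>x. [x]) ` V"
    by (auto simp: length_Suc_conv)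
  then show ?case by (simp add: card_image inj_on_def)
next
  case (Suc k)
  let ?S = "\<lambda>k. {xs. length xs = Suc k \<and> set xs \<subseteq> V \<and> distinct_adj xs}"
  have fin: "finite (?S k)"
    by (rule finite_subset[OF _ finite_lists_length_eq[OF assms, of "Suc k"]]) auto
  have "?S (Suc k) = (\<lambda>(xs, x). x # xs) ` (SIGMA xs:?S k. V - {hd xs})"
    by (fastforce simp: length_Suc_conv distinct_adj_Cons image_iff)
  moreover have "inj_on (\<lambda>(xs, x). x # xs) (SIGMA xs:?S k. V - {hd xs})"
    by (auto simp: inj_on_def)
  ultimately have "card (?S (Suc k)) = card (SIGMA xs:?S k. V - {hd xs})"
    by (simp add: card_image)
  also have "\<dots> = (\<Sum>xs\<in>?S k. card (V - {hd xs}))"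
    using fin assms by (subst card_SigmaI) auto
  also have "\<dots> = (\<Sum>xs\<in>?S k. card V - 1)"
  proof (rule sum.cong[OF refl])
    fix xs assume "xs \<in> ?S k"
    then have "hd xs \<in> V" by (cases xs) auto
    then show "card (V - {hd xs}) = card V - 1" using assms by simp
  qed
  finally show ?case using Suc.IH by simp
qed

text \<open>
  The cyclic condition splits into the condition on a path and a single condition for closing up.
\<close>

lemma closed_walks_Suc:
  "closed_walks V (Suc k) =
     {xs. length xs = Suc k \<and> set xs \<subseteq> V \<and> distinct_adj xs \<and> hd xs \<noteq> last xs}"
proof -
  have "(\<forall>i<Suc k. xs ! i \<noteq> xs ! (Suc i mod Suc k)) \<longleftrightarrow> distinct_adj xs \<and> hd xs \<noteq> last xs"
    if len: "length xs = Suc k" for xs :: "'a list"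
  proof -
    have "xs \<noteq> []" using len by auto
    then have ends: "hd xs = xs ! 0" "last xs = xs ! k"
      using len by (simp_all add: hd_conv_nth last_conv_nth)
    have "(\<forall>i<Suc k. xs ! i \<noteq> xs ! (Suc i mod Suc k)) \<longleftrightarrow>
        (\<forall>i<k. xs ! i \<noteq> xs ! (Suc i mod Suc k)) \<and> xs ! k \<noteq> xs ! (Suc k mod Suc k)"
      using less_Suc_eq by auto
    also have "(\<forall>i<k. xs ! i \<noteq> xs ! (Suc i mod Suc k)) \<longleftrightarrow> distinct_adj xs"
      using len by (simp add: distinct_adj_conv_nth)
    finally show ?thesis using ends by auto
  qed
  then show ?thesis unfolding closed_walks_def by auto
qed

lemma finite_closed_walks [simp]: "finite V \<Longrightarrow> finite (closed_walks V k)"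
  unfolding closed_walks_def
  by (rule finite_subset[OF _ finite_lists_length_eq[of V k]]) auto

lemma card_closed_walks_le:
  assumes "finite V"
  shows "card (closed_walks V (Suc k)) \<le> card V * (card V - 1) ^ k"
  unfolding card_open_walks[OF assms, symmetric] closed_walks_Suc
  by (rule card_mono[OF finite_subset[OF _ finite_lists_length_eq[OF assms, of "Suc k"]]]) auto

text \<open>
  A walk on a path whose last vertex differs from the first is a closed walk; one whose
  last vertex equals the first becomes, when that repeated vertex is dropped, a closed walk that is one
  step shorter.
\<close>

lemma card_closed_walks_rec:
  assumes "finite V"
  shows "card (closed_walks V (Suc (Suc k))) + card (closed_walks V (Suc k))
    = card V * (card V - 1) ^ Suc k"
proof -
  let ?S = "{xs. length xs = Suc (Suc k) \<and> set xs \<subseteq> V \<and> distinct_adj xs}"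
  let ?f = "\<lambda>ys. ys @ [hd ys]"
  have eq: "?S = closed_walks V (Suc (Suc k)) \<union> ?f ` closed_walks V (Suc k)" (is "_ = ?A \<union> ?B")
  proof (intro equalityI subsetI)
    fix xs assume xs: "xs \<in> ?S"
    show "xs \<in> ?A \<union> ?B"
    proof (cases "hd xs = last xs")
      case True
      obtain ys y where ys: "xs = ys @ [y]" using xs by (cases xs rule: rev_cases) auto
      with xs have "ys \<noteq> []" by auto
      with xs ys True have "y = hd ys" "ys \<in> closed_walks V (Suc k)"
        by (auto simp: closed_walks_Suc distinct_adj_append_iff)
      with ys show ?thesis by auto
    qed (use xs in \<open>auto simp: closed_walks_Suc\<close>)
next
    fix xs assume "xs \<in> ?A \<union> ?B"
    then show "xs \<in> ?S"
    proof
      assume "xs \<in> ?B"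
      then obtain ys where ys: "xs = ys @ [hd ys]" "ys \<in> closed_walks V (Suc k)" by blast
      then have "ys \<noteq> []" by (auto simp: closed_walks_Suc)
      with ys show ?thesis by (auto simp: closed_walks_Suc distinct_adj_append_iff)
    qed (auto simp: closed_walks_Suc)
  qed
  have disj: "?A \<inter> ?B = {}"
    by (auto simp: closed_walks_Suc length_Suc_conv)
  have inj: "inj_on ?f (closed_walks V (Suc k))"
    by (auto simp: inj_on_def)
  have "card ?S = card ?A + card ?B"
    unfolding eq by (rule card_Un_disjoint) (use assms disj in \<open>auto simp: finite_closed_walks\<close>)
  then show ?thesis
    using card_open_walks[OF assms, of "Suc k"] card_image[OF inj] by simp
qed

lemma card_covering_walks_le:
  assumes "finite V"
  shows "card (covering_walks V (Suc k)) \<le> card V * (card V - 1) ^ k"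
proof -
  have "card (covering_walks V (Suc k)) \<le> card (closed_walks V (Suc k))"
    by (rule card_mono) (auto simp: covering_walks_def finite_closed_walks assms)
  then show ?thesis using card_closed_walks_le[OF assms, of k] by linarith
qed

lemma covering_walks_short:
  assumes "k < card V"
  shows "covering_walks V k = {}"
proof -
  have "card V \<le> k" if "xs \<in> covering_walks V k" for xs
    using that card_mono[of "set xs" V] card_length[of xs]
    by (auto simp: covering_walks_def closed_walks_def)
  then show ?thesis using assms by fastforce
qed

text \<open>
  A union bound over the missed vertex: a closed walk that misses \<open>v\<close> is a closed walk on the complete
  graph with vertex set \<open>V - {v}\<close>. The first two terms bound the number of all closed walks from below.
\<close>

lemma card_covering_walks_ge:
  assumes "finite V" and "card V \<ge> 2"
  shows "real (card V) * (real (card V) - 1) ^ Suc k - real (card V) * (real (card V) - 1) ^ k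
      - real (card V) * ((real (card V) - 1) * (real (card V) - 2) ^ Suc k)
    \<le> real (card (covering_walks V (Suc (Suc k))))"
proof -
  define n where "n = card V"
  have n2: "n \<ge> 2" using assms by (simp add: n_def)
  let ?W = "\<lambda>U. closed_walks U (Suc (Suc k))"
  have "?W V \<subseteq> covering_walks V (Suc (Suc k)) \<union> (\<Union>v\<in>V. ?W (V - {v}))"
    by (auto simp: covering_walks_def closed_walks_def)
  then have "card (?W V) \<le> card (covering_walks V (Suc (Suc k)) \<union> (\<Union>v\<in>V. ?W (V - {v})))"
    by (intro card_mono) (auto simp: covering_walks_def assms finite_closed_walks)
  also have "\<dots> \<le> card (covering_walks V (Suc (Suc k))) + card (\<Union>v\<in>V. ?W (V - {v}))"
    by (rule card_Un_le)
  also have "card (\<Union>v\<in>V. ?W (V - {v})) \<le> (\<Sum>v\<in>V. card (?W (V - {v})))"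
    using assms by (intro card_UN_le)
  also have "\<dots> \<le> (\<Sum>v\<in>V. (n - 1) * (n - 2) ^ Suc k)"
  proof (rule sum_mono)
    fix v assume "v \<in> V"
    then show "card (?W (V - {v})) \<le> (n - 1) * (n - 2) ^ Suc k"
      using card_closed_walks_le[of "V - {v}" "Suc k"] assms
      by (simp add: n_def numeral_2_eq_2)
  qed
  also have "\<dots> = n * ((n - 1) * (n - 2) ^ Suc k)" by (simp add: n_def)
  finally have "card (?W V) \<le> card (covering_walks V (Suc (Suc k))) + n * ((n - 1) * (n - 2) ^ Suc k)"
    by simp
  moreover have "n * (n - 1) ^ Suc k \<le> card (?W V) + n * (n - 1) ^ k"
    using card_closed_walks_rec[OF assms(1), of k] card_closed_walks_le[OF assms(1), of k]
    by (simp add: n_def)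
  ultimately have "n * (n - 1) ^ Suc k \<le> card (covering_walks V (Suc (Suc k)))
      + n * ((n - 1) * (n - 2) ^ Suc k) + n * (n - 1) ^ k" by linarith
  then have "real (n * (n - 1) ^ Suc k) \<le> real (card (covering_walks V (Suc (Suc k)))
      + n * ((n - 1) * (n - 2) ^ Suc k) + n * (n - 1) ^ k)" by (simp only: of_nat_le_iff)
  then show ?thesis using n2 unfolding n_def[symmetric]
    by (simp add: of_nat_diff)
qed

section \<open>The mass of the covering loops\<close>

lemma based_loop_mass_complete_graph:
  assumes "length xs = k" and "set xs \<subseteq> V" and "k > 0"
  shows "based_loop_mass (complete_graph_walk n) c xs =
    (if xs \<in> closed_walks V k then 1 / real k * (1 / (1 + c)) ^ k * (1 / (real n - 1)) ^ k else 0)"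
proof (cases "xs \<in> closed_walks V k")
  case True
  then have "(\<Prod>i<k. complete_graph_walk n (xs ! i) (xs ! (Suc i mod k))) = (1 / (real n - 1)) ^ k"
    by (simp add: closed_walks_def complete_graph_walk_def)
  then show ?thesis using assms True by (simp add: based_loop_mass_def Let_def)
next
  case False
  then obtain i where "i < k" "xs ! i = xs ! (Suc i mod k)"
    using assms by (auto simp: closed_walks_def)
  then have "(\<Prod>i<k. complete_graph_walk n (xs ! i) (xs ! (Suc i mod k))) = 0"
    by (intro prod_zero) (auto simp: complete_graph_walk_def)
  then show ?thesis using assms False by (simp add: based_loop_mass_def Let_def)
qed

text \<open>
  The mass of all covering based loops of length \<open>k\<close>. It vanishes at \<open>k = 0\<close>, where \<open>1 / 0 = 0\<close>, so
  that sums over all natural numbers are sums over lengths.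
\<close>

definition covering_mass :: "'v set \<Rightarrow> real \<Rightarrow> nat \<Rightarrow> real" where
  "covering_mass V c k = 1 / real k * (1 / (1 + c)) ^ k
     * (real (card (covering_walks V k)) / (real (card V) - 1) ^ k)"

text \<open>
  Whether a loop covers depends only on the vertex set of any representative, so the preimage of the
  covering loops consists of the lists with set \<open>V\<close>. There are finitely many of them of each length.
\<close>

lemma emeasure_covering_loops:
  assumes "finite V" and "card V \<ge> 2" and "c > 0"
  shows "emeasure (loop_measure V (complete_graph_walk (card V)) c) (covering_loops V)
    = (\<Sum>k. ennreal (covering_mass V c k))"
proof -
  let ?f = "\<lambda>xs. ennreal (based_loop_mass (complete_graph_walk (card V)) c xs)"
  let ?P = "point_measure (based_loops V) ?f"
  define X where "X k = {xs. length xs = k \<and> xs \<noteq> [] \<and> set xs = V}" for k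
  have finX: "finite (X k)" for k
    unfolding X_def by (rule finite_subset[OF _ finite_lists_length_eq[OF assms(1), of k]]) auto
  have XB: "X k \<subseteq> based_loops V" for k by (auto simp: X_def based_loops_def)
  have cls: "loop_rel V `` {xs} \<in> covering_loops V \<longleftrightarrow> set xs = V" if "xs \<in> based_loops V" for xs
  proof -
    have "(xs, xs) \<in> loop_rel V"
      using that equiv_loop_rel[of V] by (meson equiv_class_self equivE refl_onD)
    moreover have "set ys = set xs" if "(xs, ys) \<in> loop_rel V" for ys
      using that by (auto simp: loop_rel_def)
    ultimately have "(\<forall>x\<in>V. \<exists>ys\<in>loop_rel V `` {xs}. x \<in> set ys) \<longleftrightarrow> V \<subseteq> set xs" by blast
    then show ?thesis using that
      by (auto simp: covering_loops_def loops_def based_loops_def intro: quotientI)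
  qed
  have "emeasure (loop_measure V (complete_graph_walk (card V)) c) (covering_loops V)
      = emeasure ?P ((\<lambda>xs. loop_rel V `` {xs}) -` covering_loops V \<inter> space ?P)"
    unfolding loop_measure_def based_loop_measure_def
    by (rule emeasure_distr)
       (auto simp: measurable_def space_point_measure sets_point_measure covering_loops_def loops_def
         intro: quotientI)
  also have "(\<lambda>xs. loop_rel V `` {xs}) -` covering_loops V \<inter> space ?P = (\<Union>k. X k)"
    using cls by (auto simp: X_def space_point_measure based_loops_def)
  also have "emeasure ?P (\<Union>k. X k) = (\<Sum>k. emeasure ?P (X k))"
    by (rule suminf_emeasure[symmetric])
       (use XB in \<open>auto simp: disjoint_family_on_def X_def sets_point_measure\<close>)
  also have "\<dots> = (\<Sum>k. ennreal (covering_mass V c k))"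
  proof (rule suminf_cong)
    fix k
    show "emeasure ?P (X k) = ennreal (covering_mass V c k)"
    proof (cases "k = 0")
      case True
      then have "X k = {}" by (auto simp: X_def)
      then show ?thesis using True by (simp add: covering_mass_def)
    next
      case False
      define w where "w = 1 / real k * (1 / (1 + c)) ^ k * (1 / (real (card V) - 1)) ^ k"
      have w0: "w \<ge> 0" unfolding w_def using assms by (intro mult_nonneg_nonneg zero_le_power) auto
      have "emeasure ?P (X k) = (\<Sum>xs\<in>X k. ?f xs)"
        using finX XB by (intro emeasure_point_measure_finite2) auto
      also have "\<dots> = (\<Sum>xs\<in>X k. if xs \<in> closed_walks V k then ennreal w else 0)"
        using False by (intro sum.cong refl)
          (auto simp: X_def w_def based_loop_mass_complete_graph[of _ k V])
      also have "\<dots> = (\<Sum>xs\<in>X k \<inter> closed_walks V k. ennreal w)"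
        using finX by (simp only: sum.inter_restrict)
      also have "X k \<inter> closed_walks V k = covering_walks V k"
        using False by (auto simp: X_def closed_walks_def covering_walks_def)
      also have "(\<Sum>xs\<in>covering_walks V k. ennreal w) = ennreal (real (card (covering_walks V k)) * w)"
        using w0 by (simp add: ennreal_mult ennreal_of_nat_eq_real_of_nat)
      also have "real (card (covering_walks V k)) * w = covering_mass V c k"
        by (simp add: w_def covering_mass_def power_divide)
      finally show ?thesis .
    qed
  qed
  finally show ?thesis .
qed


section \<open>Estimates for a fixed number of vertices\<close>

lemma sum_inverse_le_ln:
  assumes "1 \<le> m" and "m \<le> K"
  shows "(\<Sum>k=m..K. 1 / real k) \<le> 1 / real m + (ln (real K) - ln (real m))"
  using assms(2)
proof (induction K rule: dec_induct)
  case (step K)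
  have "ln (real K) - ln (real (Suc K)) \<le> (real K - real (Suc K)) / real (Suc K)"
    using step assms by (intro ln_diff_le) auto
  then have "1 / real (Suc K) \<le> ln (real (Suc K)) - ln (real K)"
    by (simp add: minus_divide_left[symmetric])
  then show ?case using step by (simp add: atLeastAtMostSuc_conv)
qed simp

lemma ln_le_sum_inverse:
  assumes "1 \<le> m" and "m \<le> K"
  shows "ln (real K + 1) - ln (real m) \<le> (\<Sum>k=m..K. 1 / real k)"
  using assms(2)
proof (induction K rule: dec_induct)
  case base
  then show ?case using assms ln_diff_le_inverse[of "real m"] by simp
next
  case (step K)
  have "ln (real (Suc K) + 1) - ln (real (Suc K)) < 1 / real (Suc K)"
    by (rule ln_diff_le_inverse) simp
  then show ?case using step by (simp add: atLeastAtMostSuc_conv add_ac)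
qed

lemma covering_mass_nonneg:
  assumes "card V \<ge> 2" and "c > 0"
  shows "covering_mass V c k \<ge> 0"
  using assms unfolding covering_mass_def
  by (intro mult_nonneg_nonneg divide_nonneg_nonneg zero_le_power) auto

lemma covering_mass_le:
  assumes "finite V" and "card V \<ge> 2" and "c > 0"
  shows "covering_mass V c k \<le>
    (if k < card V then 0
     else real (card V) / (real (card V) - 1) * (1 / real k * (1 / (1 + c)) ^ k))"
proof (cases "k < card V")
  case True
  then show ?thesis by (simp add: covering_mass_def covering_walks_short)
next
  case False
  define n where "n = card V"
  have n2: "n \<ge> 2" using assms by (simp add: n_def)
  obtain j where k: "k = Suc j" using False assms by (cases k) auto
  have "real (card (covering_walks V k)) \<le> real (n * (n - 1) ^ j)"
    unfolding k n_def using card_covering_walks_le[OF assms(1), of j] by (simp only: of_nat_le_iff)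
  also have "\<dots> = real n * (real n - 1) ^ j" using n2 by (simp add: of_nat_diff)
  finally have "real (card (covering_walks V k)) / (real n - 1) ^ k
      \<le> real n * (real n - 1) ^ j / (real n - 1) ^ k"
    using n2 by (intro divide_right_mono) auto
  also have "\<dots> = real n / (real n - 1)"
    using n2 by (simp add: k)
  finally have "covering_mass V c k \<le> 1 / real k * (1 / (1 + c)) ^ k * (real n / (real n - 1))"
    unfolding covering_mass_def n_def[symmetric] using assms by (intro mult_left_mono) auto
  then show ?thesis using False by (simp add: n_def mult.commute)
qed

lemma summable_covering_mass:
  assumes "finite V" and "card V \<ge> 2" and "c > 0"
  shows "summable (covering_mass V c)"
proof (rule summable_comparison_test')
  show "summable (\<lambda>k. real (card V) / (real (card V) - 1) * (1 / (1 + c)) ^ k)"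
    using assms by (intro summable_mult summable_geometric) auto
  fix k :: nat assume "k \<ge> 0"
  have "1 / real k * (1 / (1 + c)) ^ k \<le> 1 * (1 / (1 + c)) ^ k"
    using assms by (intro mult_right_mono) (auto simp: divide_simps)
  then have "(if k < card V then 0
     else real (card V) / (real (card V) - 1) * (1 / real k * (1 / (1 + c)) ^ k))
     \<le> real (card V) / (real (card V) - 1) * (1 / (1 + c)) ^ k"
    using assms mult_left_mono[of "1 / real k * (1 / (1 + c)) ^ k" "(1 / (1 + c)) ^ k"
      "real (card V) / (real (card V) - 1)"] by (auto simp del: times_divide_eq_left times_divide_eq_right)
  then show "norm (covering_mass V c k) \<le> real (card V) / (real (card V) - 1) * (1 / (1 + c)) ^ k"
    using covering_mass_le[OF assms, of k] covering_mass_nonneg[OF assms(2,3), of k] by simp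
qed

text \<open>
  Up to the cutoff \<open>K\<close> the killing factor is bounded by 1, which leaves a harmonic sum starting at the
  cover threshold \<open>n\<close>. Beyond \<open>K\<close> the factor \<open>1 / k\<close> is bounded by \<open>1 / K\<close>, which leaves a geometric
  series with sum \<open>(1 + c) / c\<close>.
\<close>

lemma suminf_covering_mass_le:
  assumes "finite V" and "card V \<ge> 2" and "c > 0" and "card V \<le> K"
  defines "n \<equiv> card V"
  shows "(\<Sum>k. covering_mass V c k)
    \<le> real n / (real n - 1) * (1 / real n + (ln (real K) - ln (real n)) + (1 + c) / (c * real K))"
proof -
  have n2: "n \<ge> 2" and nK: "n \<le> K" using assms by auto
  let ?s = "1 / (1 + c)"
  let ?g = "\<lambda>k. if k \<in> {n..K} then 1 / real k else 0"
  let ?h = "\<lambda>k. ?s ^ k * (1 / real K)"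
  have g: "?g sums (\<Sum>k=n..K. 1 / real k)" by (rule sums_If_finite_set) simp
  have "(\<lambda>k. ?s ^ k) sums (1 / (1 - ?s))" using assms by (intro geometric_sums) auto
  then have h: "?h sums (1 / (1 - ?s) * (1 / real K))" by (rule sums_mult2)
  have "(\<Sum>k. covering_mass V c k) \<le>
      real n / (real n - 1) * ((\<Sum>k=n..K. 1 / real k) + 1 / (1 - ?s) * (1 / real K))"
  proof (rule sums_le)
    show "covering_mass V c k \<le> real n / (real n - 1) * (?g k + ?h k)" for k
    proof (cases "k < n")
      case True
      have "covering_mass V c k \<le> 0" using covering_mass_le[OF assms(1-3), of k] True by (simp add: n_def)
      moreover have "0 \<le> real n / (real n - 1) * (?g k + ?h k)"
        using n2 assms by (intro mult_nonneg_nonneg add_nonneg_nonneg) auto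
      ultimately show ?thesis by linarith
    next
      case False
      have "?s ^ k \<le> 1" "?s ^ k \<ge> 0" using assms by (auto intro: power_le_one)
      then have "1 / real k * ?s ^ k \<le> ?g k + ?h k"
      proof (cases "k \<le> K")
        case True
        have "1 / real k * ?s ^ k \<le> 1 / real k * 1"
          using \<open>?s ^ k \<le> 1\<close> by (intro mult_left_mono) auto
        moreover have "0 \<le> ?h k" using \<open>?s ^ k \<ge> 0\<close> by simp
        ultimately show ?thesis using True False by simp
      next
        case F: False
        then have "1 / real k * ?s ^ k \<le> 1 / real K * ?s ^ k"
          using \<open>?s ^ k \<ge> 0\<close> nK n2 by (intro mult_right_mono) (auto intro: frac_le)
        then show ?thesis using F by simp
      qed
      then have "real n / (real n - 1) * (1 / real k * ?s ^ k) \<le> real n / (real n - 1) * (?g k + ?h k)"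
        using n2 by (intro mult_left_mono) auto
      then show ?thesis using covering_mass_le[OF assms(1-3), of k] False by (simp add: n_def)
    qed
    show "covering_mass V c sums (\<Sum>k. covering_mass V c k)"
      using summable_covering_mass[OF assms(1-3)] by (rule summable_sums)
    show "(\<lambda>k. real n / (real n - 1) * (?g k + ?h k)) sums
      (real n / (real n - 1) * ((\<Sum>k=n..K. 1 / real k) + 1 / (1 - ?s) * (1 / real K)))"
      by (intro sums_mult sums_add g h)
  qed
  also have "1 / (1 - ?s) * (1 / real K) = (1 + c) / (c * real K)"
    using assms by (simp add: field_simps)
  also have "real n / (real n - 1) * ((\<Sum>k=n..K. 1 / real k) + (1 + c) / (c * real K))
    \<le> real n / (real n - 1) * (1 / real n + (ln (real K) - ln (real n)) + (1 + c) / (c * real K))"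
    using n2 sum_inverse_le_ln[of n K] nK by (intro mult_left_mono add_right_mono) auto
  finally show ?thesis .
qed

text \<open>
  The term \<open>1 / (n - 1)\<^sup>2\<close> bounds how far the number of all closed walks falls short of \<open>(n - 1) ^ k\<close>.
  The exponential term is the union bound over the \<open>n\<close> missed vertices: a walk that is off a given
  vertex avoids it in the next step with probability \<open>1 - 1 / (n - 1) \<le> exp (- 1 / (n - 1))\<close>.
\<close>

lemma covering_fraction_ge:
  assumes "finite V" and "card V \<ge> 2" and "k \<ge> 2"
  defines "n \<equiv> card V"
  shows "1 - 1 / (real n - 1)\<^sup>2 - real n * exp (- (real k - 1) / (real n - 1))
    \<le> real (card (covering_walks V k)) / (real n - 1) ^ k"
proof -
  have n2: "n \<ge> 2" using assms by simp
  obtain j where k: "k = Suc (Suc j)" using assms(3) by (metis Suc_le_D numeral_2_eq_2 Suc_le_mono)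
  define r where "r = real n - 1"
  have r1: "r \<ge> 1" using n2 by (simp add: r_def)
  have "((r - 1) / r) ^ Suc j \<le> exp (- 1 / r) ^ Suc j"
    using r1 exp_ge_add_one_self[of "- 1 / r"] by (intro power_mono) (auto simp: field_simps)
  also have "\<dots> = exp (- (real k - 1) / r)"
    by (simp only: exp_of_nat_mult[symmetric]) (simp add: k diff_divide_distrib add_divide_distrib)
  finally have e: "((r - 1) / r) ^ Suc j \<le> exp (- (real k - 1) / r)" .
  have "1 - 1 / r\<^sup>2 - real n * exp (- (real k - 1) / r) \<le> 1 - 1 / r\<^sup>2 - real n * ((r - 1) / r) ^ Suc j"
    using e by (intro diff_left_mono mult_left_mono) auto
  also have "\<dots> = ((r + 1) * r ^ Suc j - (r + 1) * r ^ j - (r + 1) * (r * (r - 1) ^ Suc j)) / r ^ k"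
  proof -
    have n: "real n = r + 1" by (simp add: r_def)
    have "((r + 1) * r ^ Suc j - (r + 1) * r ^ j) / r ^ k = r ^ j * (r\<^sup>2 - 1) / (r ^ j * r\<^sup>2)"
      by (simp add: k power2_eq_square algebra_simps)
    also have "\<dots> = 1 - 1 / r\<^sup>2"
      using r1 by (simp add: diff_divide_distrib)
    finally have "((r + 1) * r ^ Suc j - (r + 1) * r ^ j) / r ^ k = 1 - 1 / r\<^sup>2" .
    moreover have "(r + 1) * (r * (r - 1) ^ Suc j) / r ^ k = real n * ((r - 1) / r) ^ Suc j"
      using r1 unfolding n k power_divide by simp
    ultimately show ?thesis by (simp only: diff_divide_distrib)
  qed
  also have "\<dots> \<le> real (card (covering_walks V k)) / r ^ k"
    using card_covering_walks_ge[OF assms(1,2), of j] r1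
    by (intro divide_right_mono) (auto simp: r_def n_def k)
  finally show ?thesis by (simp add: r_def)
qed

text \<open>
  On the window from \<open>K1\<close> to \<open>K2\<close> the killing factor is smallest at the upper end, where Bernoulli's
  inequality bounds it below by \<open>1 - c * K2\<close>, and the bound \<open>D\<close> for the covering fraction is smallest
  at the lower end.
\<close>

lemma suminf_covering_mass_ge:
  assumes "finite V" and "card V \<ge> 2" and "c > 0"
    and "2 \<le> K1" and "K1 \<le> K2" and "c * real K2 \<le> 1"
  defines "n \<equiv> card V"
  defines "D \<equiv> 1 - 1 / (real n - 1)\<^sup>2 - real n * exp (- (real K1 - 1) / (real n - 1))"
  assumes "D \<ge> 0"
  shows "(1 - c * real K2) * D * (ln (real K2 + 1) - ln (real K1)) \<le> (\<Sum>k. covering_mass V c k)"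
proof -
  have n2: "n \<ge> 2" using assms by simp
  have "(1 - c * real K2) * D * (ln (real K2 + 1) - ln (real K1))
      \<le> (1 - c * real K2) * D * (\<Sum>k=K1..K2. 1 / real k)"
    using assms by (intro mult_left_mono ln_le_sum_inverse) auto
  also have "\<dots> = (\<Sum>k=K1..K2. (1 - c * real K2) * D * (1 / real k))"
    by (rule sum_distrib_left)
  also have "\<dots> \<le> (\<Sum>k=K1..K2. covering_mass V c k)"
  proof (rule sum_mono)
    fix k assume k: "k \<in> {K1..K2}"
    have "1 - c * real K2 \<le> 1 + real k * (- c / (1 + c))"
    proof -
      have "real k * (c / (1 + c)) \<le> real K2 * c"
        using k assms by (intro mult_mono) (auto simp: field_simps)
      then show ?thesis by (simp add: mult.commute)
    qed
    also have "\<dots> \<le> (1 + (- c / (1 + c))) ^ k"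
      using assms by (intro Bernoulli_inequality) (auto simp: field_simps)
    also have "1 + (- c / (1 + c)) = 1 / (1 + c)" using assms by (simp add: field_simps)
    finally have s: "1 - c * real K2 \<le> (1 / (1 + c)) ^ k" .
    have "D \<le> 1 - 1 / (real n - 1)\<^sup>2 - real n * exp (- (real k - 1) / (real n - 1))"
      unfolding D_def using k n2
      by (intro diff_left_mono mult_left_mono) (auto intro: divide_right_mono)
    also have "\<dots> \<le> real (card (covering_walks V k)) / (real n - 1) ^ k"
      unfolding n_def using assms k by (intro covering_fraction_ge) auto
    finally have "(1 - c * real K2) * D
        \<le> (1 / (1 + c)) ^ k * (real (card (covering_walks V k)) / (real n - 1) ^ k)"
      using s assms by (intro mult_mono) auto
    then have "(1 / real k) * ((1 - c * real K2) * D)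
        \<le> (1 / real k) * ((1 / (1 + c)) ^ k * (real (card (covering_walks V k)) / (real n - 1) ^ k))"
      by (intro mult_left_mono) auto
    then show "(1 - c * real K2) * D * (1 / real k) \<le> covering_mass V c k"
      by (simp add: covering_mass_def n_def mult_ac)
  qed
  also have "\<dots> \<le> (\<Sum>k. covering_mass V c k)"
    using assms summable_covering_mass[of V c] covering_mass_nonneg[of V c]
    by (intro sum_le_suminf) auto
  finally show ?thesis .
qed

section \<open>Asymptotics of the intensity\<close>

text \<open>
  The cutoff \<open>K\<close> is about \<open>n powr (max a 1 + d)\<close>: the exponent exceeds 1, so that the cutoff lies above
  the cover threshold, and it makes \<open>c * K\<close> at least 1, so that the tail is bounded. The harmonic sum
  contributes \<open>(max a 1 - 1 + d) * ln n\<close>; all bounded contributions are absorbed by 4.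
\<close>

lemma covering_intensity_upper:
  fixes a :: real and V :: "nat \<Rightarrow> 'v set" and c :: "nat \<Rightarrow> real"
  assumes V: "\<And>n. n \<ge> 2 \<Longrightarrow> finite (V n) \<and> card (V n) = n"
    and c: "\<And>n. n \<ge> 2 \<Longrightarrow> c n > 0"
    and ge: "\<forall>\<^sub>F n in sequentially. real n powr (- a - d) \<le> c n"
    and d: "d > 0"
  shows "\<forall>\<^sub>F n in sequentially. (\<Sum>k. covering_mass (V n) (c n) k) / ln (real n)
    \<le> real n / (real n - 1) * ((max a 1 - 1 + d) + 4 / ln (real n))"
  using ge eventually_ge_at_top[of 2]
proof eventually_elim
  case (elim n)
  define K where "K = nat \<lceil>real n powr (max a 1 + d)\<rceil>"
  have n2: "real n \<ge> 2" using elim by simp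
  have lnn: "ln (real n) > 0" using n2 by simp
  have K1: "real n powr (max a 1 + d) \<le> real K" unfolding K_def by linarith
  have "real n powr 1 \<le> real n powr (max a 1 + d)" using n2 d by (intro powr_mono) auto
  with K1 have nK: "real n \<le> real K" and n_le: "real n \<le> real n powr (max a 1 + d)" by auto
  have K2: "real K \<le> 2 * real n powr (max a 1 + d)"
    unfolding K_def using n_le n2 by linarith
  have "ln (real K) \<le> ln (2 * real n powr (max a 1 + d))"
    using K2 nK n2 by (subst ln_le_cancel_iff) auto
  also have "\<dots> = ln 2 + (max a 1 + d) * ln (real n)"
    using n2 by (simp add: ln_mult ln_powr)
  finally have lnK: "ln (real K) \<le> ln 2 + (max a 1 + d) * ln (real n)" .
  have "1 \<le> real n powr (- a - d + (max a 1 + d))" using n2 by (intro ge_one_powr_ge_zero) auto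
  also have "\<dots> = real n powr (- a - d) * real n powr (max a 1 + d)" by (rule powr_add)
  also have "\<dots> \<le> c n * real K" using elim K1 c[of n] by (intro mult_mono) auto
  finally have cK: "1 \<le> c n * real K" .
  have cn: "c n > 0" using c elim by simp
  have "(1 + c n) / (c n * real K) = 1 / (c n * real K) + 1 / real K"
    using cn nK n2 by (simp add: field_simps)
  also have "\<dots> \<le> 1 + 1 / 2"
    using cK nK n2 by (intro add_mono) (auto simp: divide_simps)
  finally have tail: "(1 + c n) / (c n * real K) \<le> 3 / 2" by simp
  have "(\<Sum>k. covering_mass (V n) (c n) k) \<le> real n / (real n - 1) *
      (1 / real n + (ln (real K) - ln (real n)) + (1 + c n) / (c n * real K))"
    using suminf_covering_mass_le[of "V n" "c n" K] V[of n] cn elim nK by auto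
  also have "\<dots> \<le> real n / (real n - 1) * ((max a 1 - 1 + d) * ln (real n) + 4)"
  proof (rule mult_left_mono)
    have "1 / real n \<le> 1 / 2" using n2 by (intro divide_left_mono) auto
    then show "1 / real n + (ln (real K) - ln (real n)) + (1 + c n) / (c n * real K)
        \<le> (max a 1 - 1 + d) * ln (real n) + 4"
      using tail lnK ln2_le_25_over_36 by (simp only: distrib_right left_diff_distrib)
  qed (use n2 in auto)
  finally have "(\<Sum>k. covering_mass (V n) (c n) k) / ln (real n)
      \<le> real n / (real n - 1) * ((max a 1 - 1 + d) * ln (real n) + 4) / ln (real n)"
    using lnn by (intro divide_right_mono) auto
  also have "\<dots> = real n / (real n - 1) * ((max a 1 - 1 + d) + 4 / ln (real n))"
  proof -
    have "((max a 1 - 1 + d) * ln (real n) + 4) / ln (real n) = (max a 1 - 1 + d) + 4 / ln (real n)"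
      using lnn by (simp add: add_divide_distrib)
    then show ?thesis by (simp only: times_divide_eq_right[symmetric])
  qed
  finally show ?case .
qed

text \<open>
  The window of lengths runs from about \<open>n powr (1 + d)\<close>, where covering becomes overwhelmingly likely,
  to about \<open>n powr (a - 2 * d)\<close>, so that \<open>c * K2\<close> is at most \<open>n powr (- d)\<close>. The assumption
  \<open>3 * d < a - 1\<close> makes the window nonempty.
\<close>

lemma covering_intensity_lower:
  fixes a :: real and V :: "nat \<Rightarrow> 'v set" and c :: "nat \<Rightarrow> real"
  assumes V: "\<And>n. n \<ge> 2 \<Longrightarrow> finite (V n) \<and> card (V n) = n"
    and c: "\<And>n. n \<ge> 2 \<Longrightarrow> c n > 0"
    and le: "\<forall>\<^sub>F n in sequentially. c n \<le> real n powr (- a + d)"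
    and d: "d > 0" "3 * d < a - 1"
  shows "\<forall>\<^sub>F n in sequentially.
    (1 - real n powr (- d)) * (1 - 1 / (real n - 1)\<^sup>2 - real n * exp (- (real n powr d)))
      * ((a - 1 - 3 * d) - ln 2 / ln (real n))
    \<le> (\<Sum>k. covering_mass (V n) (c n) k) / ln (real n)"
proof -
  define u where "u = a - 2 * d - (1 + d)"
  have u: "u > 0" using d by (simp add: u_def)
  have "\<forall>\<^sub>F n::nat in sequentially. 3 \<le> real n powr u"
    using u by real_asymp
  moreover have "\<forall>\<^sub>F n::nat in sequentially.
      0 \<le> 1 - 1 / (real n - 1)\<^sup>2 - real n * exp (- (real n powr d))"
  proof -
    have "(\<lambda>n::nat. 1 - 1 / (real n - 1)\<^sup>2 - real n * exp (- (real n powr d))) \<longlonglongrightarrow> 1"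
      using d by real_asymp
    then show ?thesis by (auto dest!: order_tendstoD(1)[of _ _ _ 0] elim!: eventually_mono)
  qed
  ultimately show ?thesis using le eventually_ge_at_top[of 2]
  proof eventually_elim
    case (elim n)
    define K1 where "K1 = nat \<lceil>real n powr (1 + d)\<rceil>"
    define K2 where "K2 = nat \<lfloor>real n powr (a - 2 * d)\<rfloor>"
    have n2: "real n \<ge> 2" using elim by simp
    have lnn: "ln (real n) > 0" using n2 by simp
    have cn: "c n > 0" using c elim by simp
    have "real n powr 1 \<le> real n powr (1 + d)" using n2 d by (intro powr_mono) auto
    then have n_le: "real n \<le> real n powr (1 + d)" by simp
    have K1_ge: "real n powr (1 + d) \<le> real K1" unfolding K1_def by linarith
    have K1_le: "real K1 \<le> 2 * real n powr (1 + d)" unfolding K1_def using n_le n2 by linarith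
    have K2_le: "real K2 \<le> real n powr (a - 2 * d)" unfolding K2_def by simp
    have K2_ge: "real n powr (a - 2 * d) \<le> real K2 + 1" unfolding K2_def by linarith
    \<comment> \<open>The factor 3 leaves room for rounding \<open>K1\<close> up and \<open>K2\<close> down.\<close>
    have "3 * real n powr (1 + d) \<le> real n powr u * real n powr (1 + d)"
      using elim by (intro mult_right_mono) auto
    also have "\<dots> = real n powr (a - 2 * d)" by (simp add: u_def powr_add[symmetric])
    finally have "real K1 \<le> real K2" using K1_le K2_ge n_le n2 by linarith
    then have K12: "K1 \<le> K2" by simp
    have K1_2: "2 \<le> K1" using K1_ge n_le n2 by linarith
    have "c n * real K2 \<le> real n powr (- a + d) * real n powr (a - 2 * d)"
      using elim K2_le by (intro mult_mono) auto
    also have "\<dots> = real n powr (- d)" by (simp add: powr_add[symmetric])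
    finally have cK: "c n * real K2 \<le> real n powr (- d)" .
    have nd: "real n powr (- d) \<le> 1" using n2 d powr_mono[of "- d" 0 "real n"] by simp
    \<comment> \<open>Taking integer parts and passing from \<open>n\<close> to \<open>n - 1\<close> costs nothing in the exponent \<open>n powr d\<close>.\<close>
    have "real n powr d * (real n - 1) \<le> real n powr (1 + d) - 1"
      using n2 d ge_one_powr_ge_zero[of "real n" d] by (simp add: powr_add algebra_simps)
    also have "\<dots> \<le> real K1 - 1" using K1_ge by simp
    finally have "real n powr d \<le> (real K1 - 1) / (real n - 1)"
      using n2 by (simp add: pos_le_divide_eq)
    then have "1 - 1 / (real n - 1)\<^sup>2 - real n * exp (- (real n powr d))
        \<le> 1 - 1 / (real n - 1)\<^sup>2 - real n * exp (- (real K1 - 1) / (real n - 1))" (is "?E \<le> ?D")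
      by (intro diff_left_mono mult_left_mono) (simp_all only: minus_divide_left[symmetric] exp_le_cancel_iff neg_le_iff_le of_nat_0_le_iff)
    have "ln (real K1) \<le> ln (2 * real n powr (1 + d))"
      using K1_le K1_2 n2 by (subst ln_le_cancel_iff) auto
    also have "\<dots> = ln 2 + (1 + d) * ln (real n)" using n2 by (simp add: ln_mult ln_powr)
    finally have lnK1: "ln (real K1) \<le> ln 2 + (1 + d) * ln (real n)" .
    have "(a - 2 * d) * ln (real n) = ln (real n powr (a - 2 * d))" using n2 by (simp add: ln_powr)
    also have "\<dots> \<le> ln (real K2 + 1)" using K2_ge n2 by (subst ln_le_cancel_iff) auto
    finally have lnK: "(a - 1 - 3 * d) * ln (real n) - ln 2 \<le> ln (real K2 + 1) - ln (real K1)"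
      using lnK1 by (simp add: algebra_simps)
    have "(1 - real n powr (- d)) * ?E * ((a - 1 - 3 * d) * ln (real n) - ln 2)
        \<le> (1 - real n powr (- d)) * ?E * (ln (real K2 + 1) - ln (real K1))"
      using lnK nd elim by (intro mult_left_mono) auto
    also have "\<dots> \<le> (1 - c n * real K2) * ?D * (ln (real K2 + 1) - ln (real K1))"
      using nd elim cK \<open>?E \<le> ?D\<close> K12 K1_2 by (intro mult_right_mono mult_mono) auto
    also have "\<dots> \<le> (\<Sum>k. covering_mass (V n) (c n) k)"
    proof -
      have "0 \<le> ?D" using elim \<open>?E \<le> ?D\<close> by linarith
      moreover have "c n * real K2 \<le> 1" using cK nd by linarith
      ultimately show ?thesis
        using suminf_covering_mass_ge[of "V n" "c n" K1 K2] V[of n] cn elim K12 K1_2 by simp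
    qed
    finally have "(1 - real n powr (- d)) * ?E * ((a - 1 - 3 * d) * ln (real n) - ln 2) / ln (real n)
        \<le> (\<Sum>k. covering_mass (V n) (c n) k) / ln (real n)"
      using lnn by (intro divide_right_mono) auto
    moreover have "(1 - real n powr (- d)) * ?E * ((a - 1 - 3 * d) * ln (real n) - ln 2) / ln (real n)
      = (1 - real n powr (- d)) * ?E * ((a - 1 - 3 * d) - ln 2 / ln (real n))"
    proof -
      have "((a - 1 - 3 * d) * ln (real n) - ln 2) / ln (real n) = (a - 1 - 3 * d) - ln 2 / ln (real n)"
        using lnn by (simp add: diff_divide_distrib)
      then show ?thesis by (simp only: times_divide_eq_right[symmetric])
    qed
    ultimately show ?case by simp
  qed
qed

lemma covering_intensity_tendsto:
  fixes a :: real and V :: "nat \<Rightarrow> 'v set" and c :: "nat \<Rightarrow> real"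
  assumes V: "\<And>n. n \<ge> 2 \<Longrightarrow> finite (V n) \<and> card (V n) = n"
    and c: "\<And>n. n \<ge> 2 \<Longrightarrow> c n > 0"
    and e: "e \<longlonglongrightarrow> 0" "\<And>n. n \<ge> 2 \<Longrightarrow> c n = real n powr (- a + e n)"
  shows "(\<lambda>n. (\<Sum>k. covering_mass (V n) (c n) k) / ln (real n)) \<longlonglongrightarrow> max (a - 1) 0"
proof (rule order_tendstoI)
  have ge: "\<forall>\<^sub>F n in sequentially. real n powr (- a - d) \<le> c n" if "d > 0" for d
  proof -
    have "\<forall>\<^sub>F n in sequentially. - d < e n" using order_tendstoD(1)[OF e(1)] that by simp
    then show ?thesis using eventually_ge_at_top[of 2]
      by eventually_elim (simp add: e(2))
  qed
  have le: "\<forall>\<^sub>F n in sequentially. c n \<le> real n powr (- a + d)" if "d > 0" for d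
  proof -
    have "\<forall>\<^sub>F n in sequentially. e n < d" using order_tendstoD(2)[OF e(1)] that by simp
    then show ?thesis using eventually_ge_at_top[of 2]
      by eventually_elim (simp add: e(2))
  qed
  fix y :: real
  {
    assume y: "max (a - 1) 0 < y"
    \<comment> \<open>Note that \<open>max (a - 1) 0 = max a 1 - 1\<close>, so \<open>d\<close> is half of the available gap.\<close>
    define d where "d = (y - max (a - 1) 0) / 2"
    have d: "d > 0" "max a 1 - 1 + d < y" using y by (auto simp: d_def max_def field_simps)
    have "(\<lambda>n::nat. real n / (real n - 1) * ((max a 1 - 1 + d) + 4 / ln (real n)))
        \<longlonglongrightarrow> max a 1 - 1 + d"
      by real_asymp
    then have "\<forall>\<^sub>F n::nat in sequentially.
        real n / (real n - 1) * ((max a 1 - 1 + d) + 4 / ln (real n)) < y"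
      by (rule order_tendstoD(2)) (rule d(2))
    moreover have "\<forall>\<^sub>F n in sequentially. (\<Sum>k. covering_mass (V n) (c n) k) / ln (real n)
        \<le> real n / (real n - 1) * ((max a 1 - 1 + d) + 4 / ln (real n))"
      by (rule covering_intensity_upper) (use V c ge[OF d(1)] d in auto)
    ultimately show "\<forall>\<^sub>F n in sequentially. (\<Sum>k. covering_mass (V n) (c n) k) / ln (real n) < y"
      by eventually_elim linarith
  }
  assume y: "y < max (a - 1) 0"
  show "\<forall>\<^sub>F n in sequentially. y < (\<Sum>k. covering_mass (V n) (c n) k) / ln (real n)"
  proof (cases "y < 0")
    case True
    show ?thesis using eventually_ge_at_top[of 2]
    proof eventually_elim
      case (elim n)
      have "0 \<le> (\<Sum>k. covering_mass (V n) (c n) k) / ln (real n)"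
        using elim V[of n] c[of n] summable_covering_mass[of "V n" "c n"] covering_mass_nonneg[of "V n" "c n"]
        by (intro divide_nonneg_nonneg suminf_nonneg) auto
      then show ?case using True by linarith
    qed
  next
    case False
    \<comment> \<open>Here \<open>0 \<le> y < max (a - 1) 0\<close>, which forces \<open>a > 1\<close>; the lower estimate loses \<open>3 * d\<close>.\<close>
    define d where "d = (a - 1 - y) / 4"
    have d: "d > 0" "3 * d < a - 1" "y < a - 1 - 3 * d"
      using y False by (auto simp: d_def field_simps)
    have "(\<lambda>n::nat. (1 - real n powr (- d)) * (1 - 1 / (real n - 1)\<^sup>2 - real n * exp (- (real n powr d)))
      * ((a - 1 - 3 * d) - ln 2 / ln (real n))) \<longlonglongrightarrow> a - 1 - 3 * d"
      using d(1) by real_asymp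
    then have "\<forall>\<^sub>F n::nat in sequentially. y <
        (1 - real n powr (- d)) * (1 - 1 / (real n - 1)\<^sup>2 - real n * exp (- (real n powr d)))
          * ((a - 1 - 3 * d) - ln 2 / ln (real n))"
      by (rule order_tendstoD(1)) (rule d(3))
    moreover have "\<forall>\<^sub>F n in sequentially.
        (1 - real n powr (- d)) * (1 - 1 / (real n - 1)\<^sup>2 - real n * exp (- (real n powr d)))
          * ((a - 1 - 3 * d) - ln 2 / ln (real n))
        \<le> (\<Sum>k. covering_mass (V n) (c n) k) / ln (real n)"
      by (rule covering_intensity_lower) (use V c le[OF d(1)] d in auto)
    ultimately show ?thesis by eventually_elim linarith
  qed
qed

section \<open>Poisson limits\<close>

lemma pmf_poisson_dist:
  assumes "r \<ge> 0"
  shows "pmf (poisson_dist r) k = r ^ k / fact k * exp (- r)"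
  using assms by (cases k) (auto simp: poisson_dist_def)

lemma cdf_poisson_dist:
  assumes "r \<ge> 0"
  shows "cdf (distr (measure_pmf (poisson_dist r)) borel real) x
    = (\<Sum>k | real k \<le> x. r ^ k / fact k * exp (- r))"
proof -
  have "{k. real k \<le> x} \<subseteq> {..nat \<lfloor>x\<rfloor>}" by (auto simp: le_nat_floor)
  then have fin: "finite {k. real k \<le> x}" by (rule finite_subset) simp
  have "cdf (distr (measure_pmf (poisson_dist r)) borel real) x
      = measure (measure_pmf (poisson_dist r)) {k. real k \<le> x}"
    unfolding cdf_def by (subst measure_distr) (auto simp: vimage_def)
  also have "\<dots> = (\<Sum>k | real k \<le> x. pmf (poisson_dist r) k)"
    by (rule measure_measure_pmf_finite[OF fin])
  finally show ?thesis by (simp add: pmf_poisson_dist[OF assms])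
qed

text \<open>
  At every point the distribution function is a fixed finite sum of weights that are continuous in
  the mean, so it converges everywhere, not only at continuity points.
\<close>

lemma weak_conv_poisson_dist:
  assumes r: "\<And>n. n \<ge> n0 \<Longrightarrow> r n \<ge> 0" and lim: "r \<longlonglongrightarrow> r0"
    and P: "\<And>n. n \<ge> n0 \<Longrightarrow> P n = distr (measure_pmf (poisson_dist (r n))) borel real"
  shows "weak_conv_m P (distr (measure_pmf (poisson_dist r0)) borel real)"
  unfolding weak_conv_m_def weak_conv_def
proof (intro allI impI)
  fix x
  have r0: "r0 \<ge> 0"
    using lim by (rule tendsto_lowerbound) (auto intro: eventually_sequentiallyI[of n0] r)
  have "(\<lambda>n. \<Sum>k | real k \<le> x. r n ^ k / fact k * exp (- r n))
      \<longlonglongrightarrow> (\<Sum>k | real k \<le> x. r0 ^ k / fact k * exp (- r0))"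
    by (intro tendsto_intros lim) auto
  moreover have "\<forall>\<^sub>F n in sequentially.
      (\<Sum>k | real k \<le> x. r n ^ k / fact k * exp (- r n)) = cdf (P n) x"
    using eventually_ge_at_top[of n0] by eventually_elim (simp add: P r cdf_poisson_dist)
  ultimately show "(\<lambda>n. cdf (P n) x) \<longlonglongrightarrow> cdf (distr (measure_pmf (poisson_dist r0)) borel real) x"
    unfolding cdf_poisson_dist[OF r0] by (rule Lim_transform_eventually)
qed

lemma (in poisson_point_process) distr_sum_indicator:
  assumes "A \<in> sets \<nu>" and "emeasure \<nu> A < \<infinity>"
  shows "distr M borel (\<lambda>\<omega>. \<Sum>x\<in>#N \<omega>. indicator A x :: real)
    = distr (measure_pmf (poisson_dist (measure \<nu> A))) borel real"
proof -
  have count: "(\<Sum>x\<in>#m. indicator A x :: real) = real (size {#x \<in># m. x \<in> A#})" for m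
    by (induction m) auto
  have "distr M borel (\<lambda>\<omega>. \<Sum>x\<in>#N \<omega>. indicator A x :: real)
      = distr (distr M (count_space UNIV) (\<lambda>\<omega>. size {#x \<in># N \<omega>. x \<in> A#})) borel real"
    using measurable_count[OF assms(1)] by (subst distr_distr) (auto simp: comp_def count)
  then show ?thesis by (simp add: poisson_count[OF assms])
qed

theorem corollary1p3:
  fixes a :: real and V :: "nat \<Rightarrow> 'v set" and c :: "nat \<Rightarrow> real"
    and M :: "nat \<Rightarrow> 'w measure" and L :: "nat \<Rightarrow> 'w \<Rightarrow> 'v list set multiset"
  assumes "a > 0"
    and "\<And>n. n \<ge> 2 \<Longrightarrow> finite (V n) \<and> card (V n) = n"
    and "\<And>n. n \<ge> 2 \<Longrightarrow> c n > 0"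
    and "\<exists>e :: nat \<Rightarrow> real. e \<longlonglongrightarrow> 0 \<and> (\<forall>n\<ge>2. c n = real n powr (- a + e n))"
    and "\<And>n. n \<ge> 2 \<Longrightarrow>
      poisson_point_process (M n)
        (scale_measure (ennreal (1 / ln (real n))) (loop_measure (V n) (complete_graph_walk n) (c n)))
        (L n)"
  shows "weak_conv_m
    (\<lambda>n. distr (M n) borel (\<lambda>\<omega>. \<Sum>l\<in>#L n \<omega>. indicator (covering_loops (V n)) l :: real))
    (distr (measure_pmf (poisson_dist (max (a - 1) 0))) borel real)"
proof -
  define r where "r n = (\<Sum>k. covering_mass (V n) (c n) k) / ln (real n)" for n
  obtain e where e: "e \<longlonglongrightarrow> 0" "\<And>n. n \<ge> 2 \<Longrightarrow> c n = real n powr (- a + e n)"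
    using assms(4) by blast
  have lim: "r \<longlonglongrightarrow> max (a - 1) 0"
    unfolding r_def by (rule covering_intensity_tendsto[OF assms(2,3) e])
  have r0: "r n \<ge> 0" if "n \<ge> 2" for n
    unfolding r_def
    using that assms(2,3)[of n] summable_covering_mass[of "V n" "c n"] covering_mass_nonneg[of "V n" "c n"]
    by (intro divide_nonneg_nonneg suminf_nonneg) auto
  have law: "distr (M n) borel (\<lambda>\<omega>. \<Sum>l\<in>#L n \<omega>. indicator (covering_loops (V n)) l :: real)
      = distr (measure_pmf (poisson_dist (r n))) borel real" if n: "n \<ge> 2" for n
  proof -
    let ?\<mu> = "loop_measure (V n) (complete_graph_walk n) (c n)"
    let ?\<nu> = "scale_measure (ennreal (1 / ln (real n))) ?\<mu>"
    interpret poisson_point_process "M n" ?\<nu> "L n" using assms(5)[OF n] .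
    have V: "finite (V n)" "card (V n) = n" and c: "c n > 0" using assms(2,3) n by auto
    have "emeasure ?\<mu> (covering_loops (V n)) = (\<Sum>k. ennreal (covering_mass (V n) (c n) k))"
      using emeasure_covering_loops[of "V n" "c n"] V c n by simp
    also have "\<dots> = ennreal (\<Sum>k. covering_mass (V n) (c n) k)"
      using V c n summable_covering_mass[of "V n" "c n"] covering_mass_nonneg[of "V n" "c n"]
      by (intro suminf_ennreal2) auto
    finally have "emeasure ?\<nu> (covering_loops (V n)) = ennreal (r n)"
      using n by (simp add: r_def ennreal_mult'[symmetric])
    then have "emeasure ?\<nu> (covering_loops (V n)) < \<infinity>"
      and "measure ?\<nu> (covering_loops (V n)) = r n"
      using r0[OF n] by (simp_all add: measure_def)
    moreover have "covering_loops (V n) \<in> sets ?\<nu>"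
      by (auto simp: loop_measure_def covering_loops_def)
    ultimately show ?thesis using distr_sum_indicator by simp
  qed
  show ?thesis by (intro weak_conv_poisson_dist[of 2 r] r0 lim law)
qed

end
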